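(* Let $n,m\ge 1$ be integers, $\mathcal{X}$ a set of inputs, $\boldsymbol{I}:\mathcal{X}\to\mathbb{R}^n$ the (known) feature map, and let $W_S=(w_{ij})\in\mathbb{R}^{n\times m}$ and $\boldsymbol{b}_S=(b_{S,1},\dots,b_{S,m})\in\mathbb{R}^m$ be the weight matrix and bias vector of the last layer of the student network, whose output is $\mathcal{O}_{\theta,j}(\boldsymbol{x})=\max\{0,y_j(\boldsymbol{x})\}$ with $y_j(\boldsymbol{x})=b_{S,j}+\sum_{i=1}^nI_i(\boldsymbol{x})w_{ij}$, $j=1,\dots,m$. Let $j_0\in\{1,\dots,m\}$ and let $\boldsymbol{x}\in\mathcal{X}$ be any input. Let $z_{j_0}$ and $\tilde z_{j_0}$ be the values obtained by the two-step ReLU attack (described in the context) on input $\boldsymbol{x}$ with target parameter the bias $b_{S,j_0}$. Then \[ b_{S,j_0}=\frac12\,(z_{j_0}-\tilde z_{j_0}). \]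
   Context: All computations are in exact real arithmetic. The student network consists of a fixed known feature map $\boldsymbol{I}=(I_1,\dots,I_n):\mathcal{X}\to\mathbb{R}^n$ (the first $k-1$ layers of a public teacher network) followed by one fully connected layer with ReLU activation. Faults (SNIFF, sign bit flip fault), applied during an execution on $\boldsymbol{x}$: a SNIFF on the bias $b_{S,j_0}$ replaces $b_{S,j_0}$ by $-b_{S,j_0}$ in the computation of $y_{j_0}$; a SNIFF on the summation $y_{j_0}$ replaces the computed sum $y_{j_0}$ by its negative just before the activation is applied. If both are injected in the same execution, first the bias is negated, giving a sum $\tilde y_{j_0}$, and then this sum is negated, so the activation is applied to $-\tilde y_{j_0}$. Two-step ReLU attack for target bias $b_{S,j_0}$ on input $\boldsymbol{x}$: Step 1. If the correct (fault-free) value of $\mathcal{O}_{\theta,j_0}(\boldsymbol{x})$ is nonzero, let $z_{j_0}$ be this value. If it is $0$, execute the network on $\boldsymbol{x}$ again with a SNIFF on the summation $y_{j_0}$, and let $z_{j_0}$ be the negative of the faulted value of $\mathcal{O}_{\theta,j_0}(\boldsymbol{x})$. Step 2. Execute the network on $\boldsymbol{x}$ with a SNIFF on $b_{S,j_0}$. If the faulted value of $\mathcal{O}_{\theta,j_0}(\boldsymbol{x})$ is nonzero, let $\tilde z_{j_0}$ be this value. Otherwise, execute the network on $\boldsymbol{x}$ with SNIFF on both $b_{S,j_0}$ and the summation $y_{j_0}$, and let $\tilde z_{j_0}$ be the negative of the faulted value of $\mathcal{O}_{\theta,j_0}(\boldsymbol{x})$. *)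

theory Defs
  imports "HOL-Analysis.Analysis"
begin

definition relu :: "real \<Rightarrow> real" where
  "relu t = max 0 t"

text \<open>
  A sign bit flip fault (SNIFF) targets either a bias or a pre-activation sum of the last
  layer. In exact real arithmetic flipping the sign bit is negation. The faults injected in
  one execution form a set, so the empty set is the correct execution.
\<close>

datatype 'm fault = Bias_SNIFF 'm | Sum_SNIFF 'm

definition preactivation ::
    "('x \<Rightarrow> real ^ 'n) \<Rightarrow> real ^ 'm ^ 'n \<Rightarrow> real ^ 'm \<Rightarrow> 'm fault set \<Rightarrow> 'x \<Rightarrow> 'm \<Rightarrow> real" where
  "preactivation I W b F x j =
     (if Bias_SNIFF j \<in> F then - (b $ j) else b $ j) + (\<Sum>i\<in>UNIV. I x $ i * W $ i $ j)"

text \<open>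
  The preactivation already contains the effect of a bias fault; a fault on the sum is
  applied to that result, just before the activation.
\<close>

definition student_run ::
    "('x \<Rightarrow> real ^ 'n) \<Rightarrow> real ^ 'm ^ 'n \<Rightarrow> real ^ 'm \<Rightarrow> 'm fault set \<Rightarrow> 'x \<Rightarrow> real ^ 'm" where
  "student_run I W b F x =
     (\<chi> j. relu (if Sum_SNIFF j \<in> F then - preactivation I W b F x j
                 else preactivation I W b F x j))"

lemma student_run_fault_free:
  "student_run I W b {} x $ j = max 0 (b $ j + (\<Sum>i\<in>UNIV. I x $ i * W $ i $ j))"
  by (simp add: student_run_def preactivation_def relu_def)

text \<open>
  The two steps of the attack see the network only through \<open>run\<close>, which returns the output
  vector observed for a given set of injected faults and a given input.
\<close>

definition attack_step1 ::
    "('m fault set \<Rightarrow> 'x \<Rightarrow> real ^ 'm) \<Rightarrow> 'm \<Rightarrow> 'x \<Rightarrow> real" where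
  "attack_step1 run j x =
     (if run {} x $ j \<noteq> 0 then run {} x $ j
      else - (run {Sum_SNIFF j} x $ j))"

definition attack_step2 ::
    "('m fault set \<Rightarrow> 'x \<Rightarrow> real ^ 'm) \<Rightarrow> 'm \<Rightarrow> 'x \<Rightarrow> real" where
  "attack_step2 run j x =
     (if run {Bias_SNIFF j} x $ j \<noteq> 0 then run {Bias_SNIFF j} x $ j
      else - (run {Bias_SNIFF j, Sum_SNIFF j} x $ j))"

end

theory Submission
  imports Defs
begin

text \<open>
  Since \<open>y = relu y - relu (- y)\<close> and at most one of the two terms is nonzero, each step of the
  attack recovers the signed preactivation, without and with the bias fault respectively. The
  two differ only in the sign of the bias, so their difference is twice the bias.
\<close>

lemma attack_step1_student_run:
  "attack_step1 (student_run I W b) j x = b $ j + (\<Sum>i\<in>UNIV. I x $ i * W $ i $ j)"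
  by (simp add: attack_step1_def student_run_def preactivation_def relu_def max_def)

lemma attack_step2_student_run:
  "attack_step2 (student_run I W b) j x = - (b $ j) + (\<Sum>i\<in>UNIV. I x $ i * W $ i $ j)"
  by (simp add: attack_step2_def student_run_def preactivation_def relu_def max_def)

theorem theorem7:
  fixes X :: "'x set"
    and I :: "'x \<Rightarrow> real ^ 'n"
    and W\<^sub>S :: "real ^ 'm ^ 'n"
    and b\<^sub>S :: "real ^ 'm"
    and j\<^sub>0 :: 'm
    and x :: 'x
    and z z' :: real
  assumes "x \<in> X"
    and "z = attack_step1 (student_run I W\<^sub>S b\<^sub>S) j\<^sub>0 x"
    and "z' = attack_step2 (student_run I W\<^sub>S b\<^sub>S) j\<^sub>0 x"
  shows "b\<^sub>S $ j\<^sub>0 = 1 / 2 * (z - z')"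
  by (simp add: assms attack_step1_student_run attack_step2_student_run)

end
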